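(* Let $n\in\mathbb{N}$ and let $t\in\mathbb{R}$, where $t$ is not a negative integer. Then $$ \psi^{(n)}(t+1)=(-1)^{n+1}n!\sum_{k=1}^{\infty}\frac{|s(k,n)|}{k\,k!\binom{t+k}{k}}, $$ where $s(k,n)$ are the Stirling numbers of the first kind.
   Context: $\mathbb{N}=\{1,2,3,\dots\}$. $\Gamma$ is the gamma function, given for $x>0$ by $\Gamma(x)=\int_0^\infty u^{x-1}e^{-u}\,du$ and understood by analytic continuation at other arguments where it is defined; $\psi=\Gamma'/\Gamma$ is the digamma function, and $\psi^{(n)}$ is its $n$-th derivative (polygamma function). The (signed) Stirling numbers of the first kind $s(k,j)$ are defined by $x(x-1)\cdots(x-(k-1))=\sum_{j\ge0}s(k,j)x^j$. The generalized binomial coefficient is $\binom{s}{r}=\frac{\Gamma(s+1)}{\Gamma(r+1)\Gamma(s-r+1)}$, so $\binom{t+k}{k}=\frac{\Gamma(t+k+1)}{k!\,\Gamma(t+1)}$.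
   Formalization: The identity is proved for t > -1 only, since for non-integer t < -1 the series diverges (e.g. n = 1, t = -3/2, where ψ'(-1/2) = π²/2 + 4 is finite); it is also proved that, for t not a negative integer, the series converges exactly when t > -1. *)

theory Defs
  imports "HOL-Analysis.Analysis" "HOL-Computational_Algebra.Polynomial"
begin

text \<open>Signed Stirling numbers of the first kind, as the coefficients of
  \<open>x (x - 1) \<dots> (x - (k - 1))\<close>.\<close>

definition stirling1 :: "nat \<Rightarrow> nat \<Rightarrow> int" where
  "stirling1 k j = coeff (\<Prod>i<k. [:- int i, 1:]) j"

text \<open>Unlike \<^const>\<open>gbinomial\<close>, the lower argument is real.  Since \<^const>\<open>Gamma\<close> is 0 at
  its poles, the value is the intended one only where the three arguments are not
  nonpositive integers.\<close>

definition gamma_binomial :: "real \<Rightarrow> real \<Rightarrow> real" where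
  "gamma_binomial s r = Gamma (s + 1) / (Gamma (r + 1) * Gamma (s - r + 1))"

definition stirling_series_term :: "nat \<Rightarrow> real \<Rightarrow> nat \<Rightarrow> real" where
  "stirling_series_term n t k =
     \<bar>real_of_int (stirling1 k n)\<bar> / (real k * fact k * gamma_binomial (t + real k) (real k))"

end

theory Submission
  imports Defs "HOL-Combinatorics.Stirling"
begin

text \<open>
  Write \<open>x = t + 1\<close>, \<open>(x)\<^sub>k\<close> for \<^term>\<open>pochhammer x k\<close> and \<open>c(k,n) = \<bar>s(k,n)\<bar>\<close> for the unsigned
  Stirling numbers, which are the coefficients of \<open>(y)\<^sub>k\<close> as a polynomial in \<open>y\<close>.  Since
  \<open>k! binom(t+k, k) = (x)\<^sub>k\<close>, the series is \<open>S(x) = \<Sum> c(k,n) / (k (x)\<^sub>k)\<close>, and by the standard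
  expansion of the polygamma function the claim for \<open>x > 0\<close> is \<open>S(x) = \<Sum>\<^sub>j 1 / (x+j)\<^bsup>n+1\<^esup>\<close>.

  This holds because \<open>S(x) - S(x+1) = 1 / x\<^bsup>n+1\<^esup>\<close> and \<open>S(x+j)\<close> tends to \<open>0\<close>.  The summands of the
  difference are \<open>c(k,n) / (x)\<^bsub>k+1\<^esub>\<close>, so that the difference equation is the expansion of
  \<open>1 / x\<^bsup>n+1\<^esup>\<close> in inverse factorials (\<open>inverse_factorial_expansion\<close>), an induction on \<open>n\<close> in which
  the recurrence of the Stirling numbers makes everything telescope.  All limits and
  convergence questions for \<open>x > 0\<close> are settled by the one bound \<open>c(k,n) y\<^sup>n \<le> (y)\<^sub>k\<close> with \<open>0 < y < x\<close>,
  which compares the series with the quotients \<open>(y)\<^sub>k / (x)\<^sub>k\<close>.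

  For \<open>x < 0\<close> the factors \<open>x + i\<close> are eventually positive and smaller than \<open>i\<close>, so \<open>(x)\<^sub>k\<close> has
  eventually constant sign and grows at most like \<open>(k-1)!\<close>.  As \<open>c(k,n)\<close> grows at least like
  \<open>(k-1)!\<close>, the series dominates a harmonic series and diverges.
\<close>

section \<open>Rewriting the terms of the series\<close>

lemma stirling1_eq_stirling:
  "stirling1 k j = (-1) ^ (k + j) * int (stirling k j)"
proof (induction k arbitrary: j)
  case 0
  show ?case by (cases j) (simp_all add: stirling1_def)
next
  case (Suc k)
  have rec: "stirling1 (Suc k) j = (case j of 0 \<Rightarrow> 0 | Suc i \<Rightarrow> stirling1 k i) - int k * stirling1 k j"
    by (auto simp: stirling1_def mult.commute[of _ "[:_, 1:]"] coeff_pCons split: nat.splits)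
  show ?case
  proof (cases j)
    case 0
    then show ?thesis using rec Suc.IH[of 0] by (cases k) simp_all
  next
    case (Suc i)
    then show ?thesis using rec Suc.IH by (simp add: algebra_simps)
  qed
qed

lemma abs_stirling1: "\<bar>real_of_int (stirling1 k n)\<bar> = real (stirling k n)"
  by (simp add: stirling1_eq_stirling abs_mult power_abs)

lemma stirling_series_term_eq:
  assumes "t + 1 \<notin> \<int>\<^sub>\<le>\<^sub>0"
  shows "stirling_series_term n t k = real (stirling k n) / (real k * pochhammer (t + 1) k)"
proof -
  have "gamma_binomial (t + real k) (real k) = pochhammer (t + 1) k / fact k"
    using pochhammer_Gamma[OF assms, of k]
    by (simp add: gamma_binomial_def add_ac Gamma_fact[symmetric])
  then show ?thesis
    by (simp add: stirling_series_term_def abs_stirling1)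
qed

section \<open>Quotients of rising factorials\<close>

lemma pochhammer_mono:
  fixes x y :: real
  assumes "0 < x" "x \<le> y"
  shows "pochhammer x k \<le> pochhammer y k"
  unfolding pochhammer_prod using assms by (intro prod_mono) auto

text \<open>The quotients \<open>(y)\<^sub>k / (x)\<^sub>k\<close> decrease, and their consecutive differences are the summands below
  times \<open>x - y\<close>.\<close>

lemma pochhammer_quotient_convergent_summable:
  fixes x y :: real
  assumes "0 < y" "y < x"
  shows "convergent (\<lambda>k. pochhammer y k / pochhammer x k)"
    and "summable (\<lambda>k. pochhammer y k / pochhammer x k / (x + real k))"
proof -
  define a where "a = (\<lambda>k. pochhammer y k / pochhammer x k)"
  have a_pos: "a k > 0" for k
    using assms by (simp add: a_def pochhammer_pos)
  have diff: "a k - a (Suc k) = (x - y) * (a k / (x + real k))" for k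
  proof -
    have "x + real k > 0" using assms by simp
    moreover have "a (Suc k) = a k * ((y + real k) / (x + real k))"
      by (simp add: a_def pochhammer_Suc)
    ultimately show ?thesis by (simp add: field_simps)
  qed
  have "a (Suc k) \<le> a k" for k
  proof -
    have "0 \<le> (x - y) * (a k / (x + real k))"
      using assms a_pos[of k] by simp
    then show ?thesis using diff[of k] by linarith
  qed
  then have "decseq a" by (rule decseq_SucI)
  then obtain L where L: "a \<longlonglongrightarrow> L"
    using decseq_convergent[of a 0] a_pos less_imp_le by metis
  then show "convergent (\<lambda>k. pochhammer y k / pochhammer x k)"
    by (auto simp: a_def convergent_def)
  have "summable (\<lambda>k. (x - y) * (a k / (x + real k)))"
    using telescope_summable'[OF L] by (simp add: diff)
  then have "summable (\<lambda>k. a k / (x + real k))"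
    unfolding summable_cmult_iff using assms by simp
  then show "summable (\<lambda>k. pochhammer y k / pochhammer x k / (x + real k))"
    by (simp only: a_def)
qed

lemma summable_pochhammer_quotient:
  fixes x y :: real
  assumes "0 < y" "y < x"
  shows "summable (\<lambda>k. pochhammer y k / pochhammer x k / real k)"
proof (rule summable_comparison_test')
  show "summable (\<lambda>k. (x + 1) * (pochhammer y k / pochhammer x k / (x + real k)))"
    by (intro summable_mult pochhammer_quotient_convergent_summable assms)
  fix k :: nat assume k: "k \<ge> 1"
  have "x + real k \<le> (x + 1) * real k"
    using k assms by (simp add: algebra_simps)
  then have "1 / real k \<le> (x + 1) / (x + real k)"
    using k assms by (simp add: field_simps)
  then have "pochhammer y k / pochhammer x k * (1 / real k)
      \<le> pochhammer y k / pochhammer x k * ((x + 1) / (x + real k))"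
    using assms by (intro mult_left_mono) (simp_all add: pochhammer_nonneg)
  then show "norm (pochhammer y k / pochhammer x k / real k)
      \<le> (x + 1) * (pochhammer y k / pochhammer x k / (x + real k))"
    using assms by (simp add: pochhammer_nonneg mult_ac)
qed

text \<open>A nonzero limit would make the summable series above comparable to the harmonic series.\<close>

lemma pochhammer_quotient_tendsto_0:
  fixes x y :: real
  assumes "0 < y" "y < x"
  shows "(\<lambda>k. pochhammer y k / pochhammer x k) \<longlonglongrightarrow> 0"
proof -
  obtain L where L: "(\<lambda>k. pochhammer y k / pochhammer x k) \<longlonglongrightarrow> L"
    using pochhammer_quotient_convergent_summable(1)[OF assms] by (auto simp: convergent_def)
  have "L \<ge> 0"
    using L assms by (intro LIMSEQ_le_const[OF L]) (simp add: pochhammer_nonneg)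
  moreover have "\<not> L > 0"
  proof
    assume "L > 0"
    then have "eventually (\<lambda>k. pochhammer y k / pochhammer x k > L / 2) sequentially"
      using order_tendstoD(1)[OF L, of "L / 2"] by simp
    then have "eventually (\<lambda>k. norm (inverse (real k))
        \<le> 2 / L * (pochhammer y k / pochhammer x k / real k)) sequentially"
    proof eventually_elim
      case (elim k)
      then have "2 / L * (L / 2 / real k) \<le> 2 / L * (pochhammer y k / pochhammer x k / real k)"
        using \<open>L > 0\<close> by (intro mult_left_mono divide_right_mono) auto
      moreover have "2 / L * (L / 2 / real k) = norm (inverse (real k))"
        using \<open>L > 0\<close> by (simp add: inverse_eq_divide)
      ultimately show ?case by linarith
    qed
    moreover have "summable (\<lambda>k. 2 / L * (pochhammer y k / pochhammer x k / real k))"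
      by (intro summable_mult summable_pochhammer_quotient assms)
    ultimately have "summable (\<lambda>k. inverse (real k))"
      by (rule summable_comparison_test_ev)
    then show False using not_summable_harmonic[where 'a = real] by simp
  qed
  ultimately show ?thesis using L by simp
qed

section \<open>Convergence for positive arguments\<close>

text \<open>The left-hand side is a single term of the expansion of \<open>(y)\<^sub>k\<close> in powers of \<open>y\<close>, all of whose
  terms are nonnegative.\<close>

lemma stirling_times_power_le_pochhammer:
  fixes y :: real
  assumes "y > 0"
  shows "real (stirling k n) * y ^ n \<le> pochhammer y k"
proof (cases "n \<le> k")
  case True
  have "real (stirling k n) * y ^ n \<le> (\<Sum>j\<le>k. real (stirling k j) * y ^ j)"
    using True assms by (intro member_le_sum[of n "{..k}" "\<lambda>j. real (stirling k j) * y ^ j"]) auto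
  then show ?thesis by (simp add: stirling_pochhammer)
next
  case False
  then show ?thesis using assms by (simp add: pochhammer_nonneg)
qed

lemma stirling_over_pochhammer_le:
  fixes x y :: real
  assumes "x > 0" "y > 0"
  shows "real (stirling k n) / pochhammer x k \<le> 1 / y ^ n * (pochhammer y k / pochhammer x k)"
  using stirling_times_power_le_pochhammer[OF assms(2), of k n] pochhammer_pos[OF assms(1), of k] assms(2)
  by (simp add: field_simps)

lemma stirling_over_pochhammer_tendsto_0:
  fixes x :: real
  assumes "x > 0"
  shows "(\<lambda>k. real (stirling k n) / pochhammer x k) \<longlonglongrightarrow> 0"
proof (rule tendsto_sandwich)
  show "\<forall>\<^sub>F k in sequentially. 0 \<le> real (stirling k n) / pochhammer x k"
    using assms by (simp add: pochhammer_nonneg)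
  show "\<forall>\<^sub>F k in sequentially. real (stirling k n) / pochhammer x k
      \<le> 1 / (x / 2) ^ n * (pochhammer (x / 2) k / pochhammer x k)"
    using assms by (intro always_eventually allI stirling_over_pochhammer_le) auto
  have "(\<lambda>k. 1 / (x / 2) ^ n * (pochhammer (x / 2) k / pochhammer x k)) \<longlonglongrightarrow> 1 / (x / 2) ^ n * 0"
    using assms by (intro tendsto_mult tendsto_const pochhammer_quotient_tendsto_0) auto
  then show "(\<lambda>k. 1 / (x / 2) ^ n * (pochhammer (x / 2) k / pochhammer x k)) \<longlonglongrightarrow> 0"
    by simp
qed simp

lemma summable_stirling_series:
  fixes x :: real
  assumes "x > 0"
  shows "summable (\<lambda>k. real (stirling k n) / (real k * pochhammer x k))"
proof (rule summable_comparison_test')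
  show "summable (\<lambda>k. 1 / (x / 2) ^ n * (pochhammer (x / 2) k / pochhammer x k / real k))"
    using assms by (intro summable_mult summable_pochhammer_quotient) auto
  fix k :: nat assume "k \<ge> 0"
  have "real (stirling k n) / pochhammer x k / real k
      \<le> 1 / (x / 2) ^ n * (pochhammer (x / 2) k / pochhammer x k) / real k"
    using assms by (intro divide_right_mono stirling_over_pochhammer_le) auto
  then show "norm (real (stirling k n) / (real k * pochhammer x k))
      \<le> 1 / (x / 2) ^ n * (pochhammer (x / 2) k / pochhammer x k / real k)"
    using assms by (simp add: pochhammer_nonneg mult_ac)
qed

section \<open>The difference equation\<close>

text \<open>With \<open>x = (x + k) - k\<close> and the recurrence for \<open>c(k+1,n+1)\<close>, the summand for \<open>n + 1\<close> times \<open>x\<close>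
  is the summand for \<open>n\<close> plus a consecutive difference of the null sequence
  \<open>c(k,n+1) / (x)\<^sub>k\<close>.  This sequence starts at \<open>c(0,n+1) = 0\<close>, so the differences contribute nothing.\<close>

lemma inverse_factorial_expansion:
  fixes x :: real
  assumes "x > 0"
  shows "(\<lambda>k. real (stirling k n) / pochhammer x (Suc k)) sums (1 / x ^ Suc n)"
proof (induction n)
  case 0
  have "(\<lambda>k. real (stirling k 0) / pochhammer x (Suc k)) sums
      (\<Sum>k\<in>{0}. real (stirling k 0) / pochhammer x (Suc k))"
    by (rule sums_finite) auto
  then show ?case by simp
next
  case (Suc n)
  define d where "d = (\<lambda>k. real (stirling k (Suc n)) / pochhammer x k)"
  have "(\<lambda>k. d k - d (Suc k)) sums (d 0 - 0)"
    unfolding d_def by (intro telescope_sums' stirling_over_pochhammer_tendsto_0 assms)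
  then have "(\<lambda>k. d k - d (Suc k)) sums 0"
    by (simp add: d_def)
  from sums_add[OF Suc.IH this]
  have "(\<lambda>k. real (stirling k n) / pochhammer x (Suc k) + (d k - d (Suc k))) sums (1 / x ^ Suc n)"
    by simp
  moreover have "real (stirling k n) / pochhammer x (Suc k) + (d k - d (Suc k))
      = x * (real (stirling k (Suc n)) / pochhammer x (Suc k))" for k
  proof -
    define D where "D = pochhammer x (Suc k)"
    have "d k = real (stirling k (Suc n)) * (x + real k) / D"
      using assms by (simp add: d_def D_def pochhammer_Suc)
    then show ?thesis
      by (simp add: d_def D_def[symmetric] add_divide_distrib algebra_simps)
  qed
  ultimately have "(\<lambda>k. x * (real (stirling k (Suc n)) / pochhammer x (Suc k))) sums (1 / x ^ Suc n)"
    by simp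
  then have "(\<lambda>k. x * (real (stirling k (Suc n)) / pochhammer x (Suc k)) / x) sums (1 / x ^ Suc n / x)"
    by (rule sums_divide)
  moreover have "x * a / x = a" for a using assms by simp
  moreover have "1 / x ^ Suc n / x = 1 / x ^ Suc (Suc n)" by simp
  ultimately show ?case by (simp only:)
qed

text \<open>For \<open>n \<ge> 1\<close> the index \<open>k = 0\<close> contributes nothing on either side, since \<open>c(0,n) = 0\<close>.\<close>

lemma stirling_series_difference:
  fixes x :: real
  assumes "x > 0" "n \<ge> 1"
  shows "(\<Sum>k. real (stirling k n) / (real k * pochhammer x k))
       - (\<Sum>k. real (stirling k n) / (real k * pochhammer (x + 1) k)) = 1 / x ^ Suc n"
proof -
  have "real (stirling k n) / (real k * pochhammer x k)
      - real (stirling k n) / (real k * pochhammer (x + 1) k)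
      = real (stirling k n) / pochhammer x (Suc k)" for k
  proof (cases "k = 0")
    case True
    then show ?thesis using assms by (cases n) simp_all
  next
    case False
    define D where "D = pochhammer x (Suc k)"
    have "real (stirling k n) / (real k * pochhammer x k)
        = real (stirling k n) * (x + real k) / (real k * D)"
      using assms by (simp add: D_def pochhammer_Suc)
    moreover have "real (stirling k n) / (real k * pochhammer (x + 1) k)
        = real (stirling k n) * x / (real k * D)"
      using assms by (simp add: D_def pochhammer_rec)
    ultimately show ?thesis
      using False by (simp add: D_def[symmetric] diff_divide_distrib[symmetric] algebra_simps)
  qed
  then have "(\<lambda>k. real (stirling k n) / (real k * pochhammer x k)
      - real (stirling k n) / (real k * pochhammer (x + 1) k)) sums (1 / x ^ Suc n)"
    using inverse_factorial_expansion[OF assms(1), of n] by simp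
  then show ?thesis
    using assms by (subst suminf_diff) (auto intro!: summable_stirling_series simp: sums_iff)
qed

text \<open>Replacing \<open>x\<close> by \<open>x + j\<close> does not decrease any factor of \<open>(x)\<^sub>k\<close> and multiplies the first one by
  \<open>(x + j) / x\<close>, so the whole series shrinks by at least that factor.\<close>

lemma stirling_series_tendsto_0:
  fixes x :: real
  assumes "x > 0"
  shows "(\<lambda>j. \<Sum>k. real (stirling k n) / (real k * pochhammer (x + real j) k)) \<longlonglongrightarrow> 0"
proof (rule tendsto_sandwich)
  let ?S = "\<lambda>y. \<Sum>k. real (stirling k n) / (real k * pochhammer y k)"
  show "\<forall>\<^sub>F j in sequentially. 0 \<le> ?S (x + real j)"
    using assms
    by (intro always_eventually allI suminf_nonneg summable_stirling_series)
       (simp_all add: pochhammer_nonneg)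
  show "\<forall>\<^sub>F j in sequentially. ?S (x + real j) \<le> x / (x + real j) * ?S x"
  proof (intro always_eventually allI)
    fix j
    have "real (stirling k n) / (real k * pochhammer (x + real j) k)
        \<le> x / (x + real j) * (real (stirling k n) / (real k * pochhammer x k))" for k
    proof (cases k)
      case (Suc m)
      have "pochhammer (x + 1) m \<le> pochhammer (x + real j + 1) m" "pochhammer (x + 1) m > 0"
        using assms by (auto intro: pochhammer_mono simp: pochhammer_pos)
      moreover have "x + real j > 0" using assms by simp
      ultimately have "real (stirling k n) / (real k * ((x + real j) * pochhammer (x + real j + 1) m))
          \<le> real (stirling k n) / (real k * ((x + real j) * pochhammer (x + 1) m))"
        using Suc by (intro divide_left_mono mult_left_mono mult_pos_pos) auto
      then show ?thesis
        using Suc assms by (simp add: pochhammer_rec mult_ac)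
    qed simp
    then have "?S (x + real j)
        \<le> (\<Sum>k. x / (x + real j) * (real (stirling k n) / (real k * pochhammer x k)))"
      using assms by (intro suminf_le summable_mult summable_stirling_series) auto
    then show "?S (x + real j) \<le> x / (x + real j) * ?S x"
      by (simp only: suminf_mult[OF summable_stirling_series[OF assms]])
  qed
  have "filterlim (\<lambda>j. x + real j) at_top sequentially"
    by (intro filterlim_tendsto_add_at_top[OF tendsto_const] filterlim_real_sequentially)
  then have "(\<lambda>j. x / (x + real j)) \<longlonglongrightarrow> 0"
    by (intro real_tendsto_divide_at_top[OF tendsto_const])
  from tendsto_mult_right[OF this, of "?S x"]
  show "(\<lambda>j. x / (x + real j) * ?S x) \<longlonglongrightarrow> 0" by simp
qed simp

lemma stirling_series_eq_Polygamma:
  fixes x :: real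
  assumes "x > 0" "n \<ge> 1"
  shows "Polygamma n x
    = (-1) ^ (n + 1) * fact n * (\<Sum>k. real (stirling k n) / (real k * pochhammer x k))"
proof -
  let ?S = "\<lambda>y. \<Sum>k. real (stirling k n) / (real k * pochhammer y k)"
  have "(\<lambda>j. ?S (x + real j) - ?S (x + real (Suc j))) sums (?S (x + real 0) - 0)"
    by (intro telescope_sums'[of "\<lambda>j. ?S (x + real j)"] stirling_series_tendsto_0 assms)
  moreover have "?S (x + real j) - ?S (x + real (Suc j)) = inverse ((x + real j) ^ Suc n)" for j
    using stirling_series_difference[of "x + real j" n] assms by (simp add: divide_inverse add_ac)
  ultimately have "(\<lambda>j. inverse ((x + real j) ^ Suc n)) sums ?S x"
    by simp
  moreover have "(\<lambda>j. inverse ((x + real j) ^ Suc n)) sums ((-1) ^ Suc n * Polygamma n x / fact n)"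
    using assms by (intro Polygamma_LIMSEQ) auto
  ultimately have "?S x = (-1) ^ Suc n * Polygamma n x / fact n"
    by (rule sums_unique2)
  then have "(-1) ^ (n + 1) * fact n * ?S x = ((-1) ^ Suc n * (-1) ^ Suc n) * Polygamma n x"
    by simp
  also have "(-1) ^ Suc n * (-1) ^ Suc n = (1 :: real)"
    by (simp flip: power_mult_distrib)
  finally show ?thesis by simp
qed

section \<open>Divergence for negative arguments\<close>

lemma fact_le_stirling:
  assumes "n \<ge> 1"
  shows "fact (n + m - 1) \<le> fact (n - 1) * stirling (n + m) n"
proof (induction m)
  case (Suc m)
  obtain p where p: "n = Suc p" using assms by (cases n) auto
  have "fact (n + Suc m - 1) = (n + m) * fact (n + m - 1)"
    by (simp add: p)
  also have "\<dots> \<le> (n + m) * (fact (n - 1) * stirling (n + m) n)"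
    using Suc.IH by (rule mult_left_mono) simp
  also have "\<dots> \<le> fact (n - 1) * stirling (n + Suc m) n"
    by (simp add: p algebra_simps)
  finally show ?case .
qed simp

text \<open>From the index \<open>N\<close> on every new factor \<open>x + i\<close> of \<open>(x)\<^sub>k\<close> lies in \<open>(0, i)\<close>.  Hence the sign of
  \<open>(x)\<^sub>k\<close> stays equal to \<open>s\<close>, and \<open>\<bar>(x)\<^sub>k\<bar> / (k-1)!\<close> no longer increases.\<close>

lemma not_summable_stirling_series:
  fixes x :: real
  assumes "x < 0" "x \<notin> \<int>\<^sub>\<le>\<^sub>0" "n \<ge> 1"
  shows "\<not> summable (\<lambda>k. real (stirling k n) / (real k * pochhammer x k))"
proof
  assume summ: "summable (\<lambda>k. real (stirling k n) / (real k * pochhammer x k))"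
  obtain N0 where N0: "- x < real N0" using reals_Archimedean2 by blast
  define N where "N = N0 + n"
  define s where "s = sgn (pochhammer x N)"
  define C where "C = \<bar>pochhammer x N\<bar> / fact (N - 1)"
  have N: "- x < real N" "n \<le> N" "N \<ge> 1"
    using N0 assms by (auto simp: N_def)
  have nz: "pochhammer x k \<noteq> 0" for k
    using assms(2) by (auto simp: pochhammer_eq_0_iff)
  have C_pos: "C > 0" using nz by (simp add: C_def)
  have bound: "0 < s * pochhammer x (N + m) \<and> s * pochhammer x (N + m) \<le> C * fact (N + m - 1)" for m
  proof (induction m)
    case 0
    then show ?case using nz[of N] by (simp add: s_def C_def linordered_idom_class.abs_sgn mult_ac zero_less_mult_iff sgn_if)
  next
    case (Suc m)
    have pos: "x + real (N + m) > 0" and le: "x + real (N + m) \<le> real (N + m)"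
      using N assms(1) by auto
    have P: "s * pochhammer x (N + Suc m) = (s * pochhammer x (N + m)) * (x + real (N + m))"
      by (simp add: pochhammer_Suc)
    have "(s * pochhammer x (N + m)) * (x + real (N + m))
        \<le> (C * fact (N + m - 1)) * real (N + m)"
      using Suc.IH pos le C_pos by - (rule mult_mono; simp)
    also have "\<dots> = C * fact (N + Suc m - 1)"
      using N(3) by (cases N) simp_all
    finally have "s * pochhammer x (N + Suc m) \<le> C * fact (N + Suc m - 1)"
      by (simp only: P)
    moreover have "0 < s * pochhammer x (N + Suc m)"
      unfolding P using Suc.IH pos by (blast intro: mult_pos_pos)
    ultimately show ?case by blast
  qed
  have harmonic_le: "norm (inverse (real k))
      \<le> C * fact (n - 1) * (s * (real (stirling k n) / (real k * pochhammer x k)))" if kN: "k \<ge> N" for k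
  proof -
    obtain m where m: "k = N + m" using le_Suc_ex[OF kN] by blast
    define F where "F = (fact (k - 1) :: real)"
    have k: "k \<ge> 1" using kN N(3) by linarith
    have "real (fact (n + (k - n) - 1)) \<le> real (fact (n - 1) * stirling (n + (k - n)) n)"
      by (rule of_nat_mono[OF fact_le_stirling[OF assms(3)]])
    then have st: "F \<le> fact (n - 1) * real (stirling k n)"
      using kN N(2) by (simp add: F_def)
    have P: "0 < s * pochhammer x k" "s * pochhammer x k \<le> C * F"
      using bound[of m] by (simp_all add: m F_def)
    have "s * (real (stirling k n) / (real k * pochhammer x k))
        = real (stirling k n) / (real k * (s * pochhammer x k))"
      using nz[of N] nz[of k] by (auto simp: s_def sgn_if)
    moreover have "inverse (real k) \<le> C * fact (n - 1) * (real (stirling k n) / (real k * (s * pochhammer x k)))"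
    proof -
      have "s * pochhammer x k \<le> C * (fact (n - 1) * real (stirling k n))"
        using P(2) mult_left_mono[OF st, of C] C_pos by linarith
      then show ?thesis using P(1) k by (simp add: field_simps)
    qed
    ultimately show ?thesis by simp
  qed
  have "summable (\<lambda>k. C * fact (n - 1) * (s * (real (stirling k n) / (real k * pochhammer x k))))"
    using summ by (intro summable_mult)
  then have "summable (\<lambda>k. inverse (real k))"
    by (rule summable_comparison_test'[OF _ harmonic_le])
  then show False using not_summable_harmonic[where 'a = real] by simp
qed

section \<open>The polygamma series\<close>

theorem theorem2p20:
  fixes n :: nat and t :: real
  assumes "n \<ge> 1"
    and "\<not> (\<exists>m::nat. m \<ge> 1 \<and> t = - real m)"
  shows "(summable (\<lambda>k. stirling_series_term n t (Suc k)) \<longleftrightarrow> t > -1) \<and>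
    (t > -1 \<longrightarrow>
      (deriv ^^ n) (Digamma :: real \<Rightarrow> real) (t + 1) =
        (-1) ^ (n + 1) * fact n * (\<Sum>k. stirling_series_term n t (Suc k)))"
proof -
  define f where "f = (\<lambda>k. real (stirling k n) / (real k * pochhammer (t + 1) k))"
  have nonpole: "t + 1 \<notin> \<int>\<^sub>\<le>\<^sub>0"
  proof
    assume "t + 1 \<in> \<int>\<^sub>\<le>\<^sub>0"
    then obtain m where "t + 1 = - real m" by (auto elim: nonpos_Ints_cases')
    then have "Suc m \<ge> 1 \<and> t = - real (Suc m)" by simp
    then show False using assms(2) by blast
  qed
  have terms: "stirling_series_term n t (Suc k) = f (Suc k)" for k
    by (simp only: stirling_series_term_eq[OF nonpole] f_def)
  have summ: "summable (\<lambda>k. f (Suc k)) \<longleftrightarrow> summable f"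
    by (rule summable_Suc_iff)
  have "t \<noteq> -1" using nonpole by auto
  then have "summable f \<longleftrightarrow> t > -1"
    using summable_stirling_series[of "t + 1" n] not_summable_stirling_series[of "t + 1" n]
      nonpole assms(1)
    unfolding f_def by (cases "t > -1") auto
  moreover have "(deriv ^^ n) (Digamma :: real \<Rightarrow> real) (t + 1) =
      (-1) ^ (n + 1) * fact n * (\<Sum>k. f (Suc k))" if t: "t > -1"
  proof -
    have "summable f" using t calculation by simp
    from suminf_split_head[OF this] have "(\<Sum>k. f (Suc k)) = suminf f"
      by (simp add: f_def)
    then show ?thesis
      using stirling_series_eq_Polygamma[of "t + 1" n] higher_deriv_Polygamma[OF nonpole, of n 0]
        t assms(1)
      by (simp add: f_def)
  qed
  ultimately show ?thesis by (simp add: terms summ)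
qed

end
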